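(* Let $(X,p)$ be a TVS-cone metric space over a cone $P$ in a real Hausdorff locally convex topological vector space $E$, let $e\in\operatorname{int}P$, and let $(X,d_p)$ be its corresponding metric space, $d_p=\xi_e\circ p$. Assume $T:X\to X$ is a mapping such that $p(Tx,Ty)\le\varphi(p(x,y))$ for all $x,y\in X$, where $\varphi:P\to P$ is increasing, continuous, $\varphi(0)=0$ and $\varphi(re)\ll re$ for every real number $r>0$. Then there exists a continuous increasing mapping $\phi:\mathbb{R}^+\to\mathbb{R}^+$ such that $\phi(t)<t$ for $t>0$ and $d_p(Tx,Ty)\le\phi(d_p(x,y))$ for all $x,y\in X$.
   Context: A cone is a non-empty subset $P\subset E$ with $P+P\subset P$, $\lambda P\subset P$ for all $\lambda\ge 0$, and $P\cap(-P)=\{0\}$; $P$ is always assumed closed with nonempty interior $\operatorname{int}P$. Write $x\le y$ iff $y-x\in P$, and $x\ll y$ iff $y-x\in\operatorname{int}P$. A TVS-cone metric space (TVS-CMS) $(X,p)$ over $P$ is a non-empty set $X$ with a map $p:X\times X\to E$ such that for all $x,y,z\in X$: $0\le p(x,y)$; $p(x,y)=0$ iff $x=y$; $p(x,y)=p(y,x)$; $p(x,y)\le p(x,z)+p(z,y)$. For $e\in\operatorname{int}P$ the nonlinear scalarization function $\xi_e:E\to\mathbb{R}$ is $\xi_e(y)=\inf\{t\in\mathbb{R}: y\in te-P\}$; it is known that $d_p=\xi_e\circ p:X\times X\to[0,\infty)$ is a metric on $X$. $\mathbb{R}^+=[0,\infty)$. "Increasing" means order-preserving ($u\le v$ implies $\varphi(u)\le\varphi(v)$).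 *)

theory Defs
  imports "HOL-Analysis.Analysis"
begin

text \<open>The constant \<open>convex\<close> has sort constraint \<open>real_vector\<close>, which is not admissible in a
  class specification, hence its definition is written out there; lemma \<open>locally_convex\<close>
  restates the axiom.\<close>

class locally_convex_t2_space = real_vector + t2_space + topological_ab_group_add +
  assumes tendsto_scaleR_Pair:
    "LIM x (nhds a \<times>\<^sub>F nhds b). fst x *\<^sub>R snd x :> nhds (a *\<^sub>R b)"
  assumes locally_convex_raw:
    "open U \<Longrightarrow> 0 \<in> U \<Longrightarrow> \<exists>V. open V \<and> 0 \<in> V \<and> V \<subseteq> U \<and>
       (\<forall>x\<in>V. \<forall>y\<in>V. \<forall>u\<ge>0. \<forall>v\<ge>0. u + v = 1 \<longrightarrow> u *\<^sub>R x + v *\<^sub>R y \<in> V)"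

lemma locally_convex:
  fixes U :: "'e::locally_convex_t2_space set"
  assumes "open U" "0 \<in> U"
  shows "\<exists>V. open V \<and> 0 \<in> V \<and> V \<subseteq> U \<and> convex V"
  using locally_convex_raw[OF assms] unfolding convex_def .

definition tvs_cone :: "'e::locally_convex_t2_space set \<Rightarrow> bool" where
  "tvs_cone P \<longleftrightarrow>
     P \<noteq> {} \<and>
     (\<forall>u\<in>P. \<forall>v\<in>P. u + v \<in> P) \<and>
     (\<forall>c\<ge>0. \<forall>u\<in>P. c *\<^sub>R u \<in> P) \<and>
     P \<inter> uminus ` P = {0} \<and>
     closed P \<and>
     interior P \<noteq> {}"

definition cone_le :: "'e::locally_convex_t2_space set \<Rightarrow> 'e \<Rightarrow> 'e \<Rightarrow> bool" where
  "cone_le P u v \<longleftrightarrow> v - u \<in> P"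

definition cone_ll :: "'e::locally_convex_t2_space set \<Rightarrow> 'e \<Rightarrow> 'e \<Rightarrow> bool" where
  "cone_ll P u v \<longleftrightarrow> v - u \<in> interior P"

definition tvs_cone_metric_space ::
    "'e::locally_convex_t2_space set \<Rightarrow> 'a set \<Rightarrow> ('a \<Rightarrow> 'a \<Rightarrow> 'e) \<Rightarrow> bool" where
  "tvs_cone_metric_space P X p \<longleftrightarrow>
     X \<noteq> {} \<and>
     (\<forall>x\<in>X. \<forall>y\<in>X. cone_le P 0 (p x y)) \<and>
     (\<forall>x\<in>X. \<forall>y\<in>X. p x y = 0 \<longleftrightarrow> x = y) \<and>
     (\<forall>x\<in>X. \<forall>y\<in>X. p x y = p y x) \<and>
     (\<forall>x\<in>X. \<forall>y\<in>X. \<forall>z\<in>X. cone_le P (p x y) (p x z + p z y))"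

text \<open>The set below is non-empty and bounded below whenever \<open>P\<close> is a cone with \<open>e\<close> in its
  interior and the space is not \<open>{0}\<close>. On the space \<open>{0}\<close> it is all of \<open>\<real>\<close>, so that
  its infimum is not a real number.\<close>

definition scalarization :: "'e::locally_convex_t2_space set \<Rightarrow> 'e \<Rightarrow> 'e \<Rightarrow> real" where
  "scalarization P e y = Inf {t. y \<in> (\<lambda>q. t *\<^sub>R e - q) ` P}"

definition scalarized_dist ::
    "'e::locally_convex_t2_space set \<Rightarrow> 'e \<Rightarrow> ('a \<Rightarrow> 'a \<Rightarrow> 'e) \<Rightarrow> 'a \<Rightarrow> 'a \<Rightarrow> real" where
  "scalarized_dist P e p x y = scalarization P e (p x y)"

end

theory Submission
  imports Defs
begin

text \<open>Put \<open>\<psi> t = \<xi>\<^sub>e (\<phi> (t e))\<close>: the behaviour of \<open>\<phi>\<close> on the ray through \<open>e\<close>, read off by the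
  scalarization. What makes this work is that the infimum defining \<open>\<xi>\<^sub>e y\<close> is attained, so that
  \<open>\<xi>\<^sub>e y \<le> t\<close> holds exactly when \<open>y \<le> t e\<close> (\<open>scalarization_le_iff\<close>), and that the strict version
  \<open>\<xi>\<^sub>e y < t\<close> holds exactly when \<open>y \<lless> t e\<close> (\<open>scalarization_less_iff\<close>).

  The first equivalence gives \<open>p x y \<le> \<xi>\<^sub>e (p x y) e\<close>. Monotonicity of \<open>\<phi>\<close> moves the bound to
  \<open>p (T x) (T y) \<le> \<phi> (p x y) \<le> \<phi> (\<xi>\<^sub>e (p x y) e)\<close>, and applying the monotone \<open>\<xi>\<^sub>e\<close> yields the
  contraction inequality for \<open>\<psi>\<close>. The second equivalence turns \<open>\<phi> (t e) \<lless> t e\<close> into \<open>\<psi> t < t\<close>.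
  Together they say that the sublevel sets \<open>{\<xi>\<^sub>e < t}\<close> and \<open>{\<xi>\<^sub>e \<le> t}\<close> are preimages of the open set
  \<open>interior P\<close> and of the closed set \<open>P\<close> under \<open>y \<mapsto> t e - y\<close>; hence \<open>\<xi>\<^sub>e\<close>, and with it \<open>\<psi>\<close>, is
  continuous.\<close>

lemma tendsto_scaleR_tvs:
  fixes g :: "'b \<Rightarrow> 'e::locally_convex_t2_space"
  assumes "(f \<longlongrightarrow> a) F" "(g \<longlongrightarrow> b) F"
  shows "((\<lambda>x. f x *\<^sub>R g x) \<longlongrightarrow> a *\<^sub>R b) F"
  using filterlim_compose[OF tendsto_scaleR_Pair filterlim_Pair[OF assms]] by simp

lemma continuous_on_scaleR_tvs:
  fixes g :: "'b::topological_space \<Rightarrow> 'e::locally_convex_t2_space"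
  assumes "continuous_on S f" "continuous_on S g"
  shows "continuous_on S (\<lambda>x. f x *\<^sub>R g x)"
  using assms unfolding continuous_on_def by (auto intro: tendsto_scaleR_tvs)

locale solid_cone =
  fixes P :: "'e::locally_convex_t2_space set" and e :: 'e
  assumes cone: "tvs_cone P"
    and unit: "e \<in> interior P"
    and nontrivial: "(UNIV :: 'e set) \<noteq> {0}"
begin

abbreviation \<xi> :: "'e \<Rightarrow> real" where
  "\<xi> \<equiv> scalarization P e"

lemma cone_add: "u \<in> P \<Longrightarrow> v \<in> P \<Longrightarrow> u + v \<in> P"
  and cone_scale: "c \<ge> 0 \<Longrightarrow> u \<in> P \<Longrightarrow> c *\<^sub>R u \<in> P"
  and cone_closed: "closed P"
  using cone by (auto simp: tvs_cone_def)

lemma cone_pointed: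
  assumes "u \<in> P" "- u \<in> P"
  shows "u = 0"
proof -
  have "u \<in> P \<inter> uminus ` P"
    using assms imageI[of "- u" P uminus] by simp
  then show "u = 0" using cone by (auto simp: tvs_cone_def)
qed

lemma ray_in_cone: "t \<ge> 0 \<Longrightarrow> t *\<^sub>R e \<in> P"
  using unit interior_subset by (blast intro: cone_scale)

text \<open>The line \<open>t \<mapsto> z + t v\<close> is continuous, so it stays in the interior for a short time after
  leaving \<open>z\<close>.\<close>

lemma interior_perturb:
  assumes "z \<in> interior P"
  obtains d :: real where "d > 0" "z + d *\<^sub>R v \<in> interior P"
proof -
  have "((\<lambda>t::real. z + t *\<^sub>R v) \<longlongrightarrow> z + 0 *\<^sub>R v) (at_right 0)"
    by (intro tendsto_add tendsto_scaleR_tvs tendsto_const tendsto_ident_at)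
  then have "eventually (\<lambda>t. z + t *\<^sub>R v \<in> interior P) (at_right 0)"
    using assms by (auto dest: topological_tendstoD[OF _ open_interior])
  then have "eventually (\<lambda>t. t > 0 \<and> z + t *\<^sub>R v \<in> interior P) (at_right 0)"
    by (intro eventually_conj eventually_at_right_less)
  then show thesis
    using that by (auto dest!: eventually_happens simp: trivial_limit_at_right_real)
qed

lemma unit_dominates:
  obtains s where "s *\<^sub>R e - y \<in> P"
proof -
  obtain d :: real where d: "d > 0" "e + d *\<^sub>R (- y) \<in> interior P"
    using interior_perturb[OF unit] by blast
  then have "(1 / d) *\<^sub>R (e + d *\<^sub>R (- y)) \<in> P"
    using interior_subset by (intro cone_scale) auto
  then have "(1 / d) *\<^sub>R e - y \<in> P"
    using d by (simp add: algebra_simps)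
  then show thesis by (rule that)
qed

text \<open>If \<open>-e\<close> belonged to the cone, pointedness would put \<open>e = 0\<close> in the interior; a cone that is a
  neighbourhood of \<open>0\<close> is the whole space, and pointedness would then collapse the space to
  \<open>{0}\<close>.\<close>

lemma minus_unit_notin_cone: "- e \<notin> P"
proof
  assume "- e \<in> P"
  then have "e = 0"
    using unit interior_subset cone_pointed by blast
  have whole: "y \<in> P" for y
    using unit_dominates[of "- y"] \<open>e = 0\<close> by auto
  have "y = 0" for y :: 'e
    by (rule cone_pointed[OF whole whole])
  then show False using nontrivial by auto
qed

lemma ray_in_cone_iff: "t *\<^sub>R e \<in> P \<longleftrightarrow> t \<ge> 0"
proof
  assume te: "t *\<^sub>R e \<in> P"
  show "t \<ge> 0"
  proof (rule ccontr)
    assume "\<not> t \<ge> 0"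
    then have "t < 0" by simp
    then have "(- 1 / t) *\<^sub>R (t *\<^sub>R e) \<in> P"
      by (intro cone_scale[OF _ te]) (simp add: divide_nonpos_neg)
    also have "(- 1 / t) *\<^sub>R (t *\<^sub>R e) = ((- 1 / t) * t) *\<^sub>R e"
      by (rule scaleR_scaleR)
    also have "(- 1 / t) * t = - 1"
      using \<open>t < 0\<close> by simp
    finally show False
      using minus_unit_notin_cone by simp
  qed
qed (rule ray_in_cone)

lemma cone_add_interior:
  assumes "u \<in> interior P" "v \<in> P"
  shows "u + v \<in> interior P"
proof (rule interiorI)
  have "continuous_on UNIV (\<lambda>z. z - v)" by (intro continuous_intros)
  then show "open ((\<lambda>z. z - v) -` interior P)"
    by (rule open_vimage[OF open_interior])
  show "u + v \<in> (\<lambda>z. z - v) -` interior P" using assms by simp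
  show "(\<lambda>z. z - v) -` interior P \<subseteq> P"
  proof
    fix z assume "z \<in> (\<lambda>z. z - v) -` interior P"
    then have "(z - v) + v \<in> P"
      using assms interior_subset by (intro cone_add) auto
    then show "z \<in> P" by simp
  qed
qed

lemma scale_unit_interior:
  assumes "c > 0"
  shows "c *\<^sub>R e \<in> interior P"
proof (rule interiorI)
  have "continuous_on UNIV (\<lambda>z::'e. (1 / c) *\<^sub>R z)"
    by (intro continuous_on_scaleR_tvs continuous_intros)
  then show "open ((\<lambda>z. (1 / c) *\<^sub>R z) -` interior P)"
    by (rule open_vimage[OF open_interior])
  show "c *\<^sub>R e \<in> (\<lambda>z. (1 / c) *\<^sub>R z) -` interior P"
    using assms unit by simp
  show "(\<lambda>z. (1 / c) *\<^sub>R z) -` interior P \<subseteq> P"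
  proof
    fix z assume "z \<in> (\<lambda>z. (1 / c) *\<^sub>R z) -` interior P"
    then have "(1 / c) *\<^sub>R z \<in> P"
      using interior_subset by blast
    then have "c *\<^sub>R ((1 / c) *\<^sub>R z) \<in> P"
      using assms by (rule cone_scale[OF less_imp_le, rotated])
    then show "z \<in> P" using assms by simp
  qed
qed

lemma scalarization_eq: "\<xi> y = Inf {t. t *\<^sub>R e - y \<in> P}"
proof -
  have "y \<in> (\<lambda>q. t *\<^sub>R e - q) ` P \<longleftrightarrow> t *\<^sub>R e - y \<in> P" for t
    by (auto intro: image_eqI[of _ _ "t *\<^sub>R e - y"])
  then show ?thesis by (simp add: scalarization_def)
qed

text \<open>The set of admissible \<open>t\<close> is non-empty and bounded below, because some multiple of \<open>e\<close>
  dominates \<open>y\<close> and some multiple dominates \<open>-y\<close>. It is closed because \<open>P\<close> is, so it contains its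
  infimum, and it is closed upwards because \<open>e\<close> is positive. Hence it is the half-line
  \<open>{\<xi> y..}\<close>.\<close>

lemma scalarization_le_iff: "\<xi> y \<le> t \<longleftrightarrow> t *\<^sub>R e - y \<in> P"
proof -
  let ?S = "{t. t *\<^sub>R e - y \<in> P}"
  obtain s where s: "s *\<^sub>R e - (- y) \<in> P" by (rule unit_dominates)
  have "- s \<le> r" if "r \<in> ?S" for r
  proof -
    have "(r *\<^sub>R e - y) + (s *\<^sub>R e - (- y)) \<in> P"
      using that s by (intro cone_add) auto
    then have "(r + s) *\<^sub>R e \<in> P" by (simp add: algebra_simps)
    then show ?thesis by (simp add: ray_in_cone_iff)
  qed
  then have bdd: "bdd_below ?S" by (rule bdd_belowI)
  have "continuous_on UNIV (\<lambda>t. t *\<^sub>R e - y)"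
    by (intro continuous_intros continuous_on_scaleR_tvs)
  then have "closed ((\<lambda>t. t *\<^sub>R e - y) -` P)"
    by (rule closed_vimage[OF cone_closed])
  then have "closed ?S" by (simp add: vimage_def)
  moreover have "?S \<noteq> {}" using unit_dominates[of y] by blast
  ultimately have attained: "\<xi> y *\<^sub>R e - y \<in> P"
    using closed_contains_Inf[OF _ bdd] by (simp add: scalarization_eq)
  show ?thesis
  proof
    assume "\<xi> y \<le> t"
    then have "(t - \<xi> y) *\<^sub>R e + (\<xi> y *\<^sub>R e - y) \<in> P"
      using attained by (intro cone_add ray_in_cone) auto
    then show "t *\<^sub>R e - y \<in> P" by (simp add: algebra_simps)
  next
    assume "t *\<^sub>R e - y \<in> P"
    then show "\<xi> y \<le> t"
      unfolding scalarization_eq by (intro cInf_lower bdd) simp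
  qed
qed

lemma scalarization_less_iff: "\<xi> y < t \<longleftrightarrow> t *\<^sub>R e - y \<in> interior P"
proof
  assume "\<xi> y < t"
  then have "(t - \<xi> y) *\<^sub>R e + (\<xi> y *\<^sub>R e - y) \<in> interior P"
    by (intro cone_add_interior scale_unit_interior) (auto simp flip: scalarization_le_iff)
  then show "t *\<^sub>R e - y \<in> interior P" by (simp add: algebra_simps)
next
  assume "t *\<^sub>R e - y \<in> interior P"
  then obtain d :: real where d: "d > 0" "(t *\<^sub>R e - y) + d *\<^sub>R (- e) \<in> interior P"
    by (rule interior_perturb)
  then have "(t - d) *\<^sub>R e - y \<in> P"
    using interior_subset[of P] by (auto simp: algebra_simps)
  then show "\<xi> y < t"
    using d by (simp flip: scalarization_le_iff)
qed

lemma scalarization_bound: "cone_le P y (\<xi> y *\<^sub>R e)"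
  unfolding cone_le_def by (rule scalarization_le_iff[THEN iffD1, OF order_refl])

lemma scalarization_mono:
  assumes "cone_le P u v"
  shows "\<xi> u \<le> \<xi> v"
proof -
  have "(\<xi> v *\<^sub>R e - v) + (v - u) \<in> P"
    using scalarization_bound[of v] assms unfolding cone_le_def by (rule cone_add)
  then show ?thesis by (simp add: scalarization_le_iff)
qed

lemma scalarization_nonneg:
  assumes "y \<in> P"
  shows "\<xi> y \<ge> 0"
proof -
  have "(\<xi> y *\<^sub>R e - y) + y \<in> P"
    using scalarization_bound[of y] assms unfolding cone_le_def by (rule cone_add)
  then show ?thesis by (simp add: ray_in_cone_iff)
qed

lemma continuous_on_scalarization: "continuous_on UNIV \<xi>"
proof -
  have cont: "continuous_on UNIV (\<lambda>y. a *\<^sub>R e - y)" for a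
    by (intro continuous_intros)
  have below: "open {y. \<xi> y < a}" for a
    using open_vimage[OF open_interior cont]
    by (simp add: scalarization_less_iff vimage_def)
  have above: "open {y. a < \<xi> y}" for a
  proof -
    have "{y. a < \<xi> y} = (\<lambda>y. a *\<^sub>R e - y) -` (- P)"
      by (auto simp flip: scalarization_le_iff)
    then show ?thesis
      using open_vimage[OF _ cont] cone_closed by (simp add: open_Compl)
  qed
  have "(\<xi> \<longlongrightarrow> \<xi> z) (at z)" for z
  proof (rule order_tendstoI)
    fix a assume "a < \<xi> z"
    then show "eventually (\<lambda>y. a < \<xi> y) (at z)"
      using eventually_at_in_open'[OF above[of a]] by simp
  next
    fix a assume "\<xi> z < a"
    then show "eventually (\<lambda>y. \<xi> y < a) (at z)"
      using eventually_at_in_open'[OF below[of a]] by simp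
  qed
  then show ?thesis
    by (simp add: continuous_on_def)
qed

end

theorem theorem33:
  fixes P :: "'e::locally_convex_t2_space set"
    and e :: 'e
    and X :: "'a set"
    and p :: "'a \<Rightarrow> 'a \<Rightarrow> 'e"
    and T :: "'a \<Rightarrow> 'a"
    and \<phi> :: "'e \<Rightarrow> 'e"
  assumes nontrivial: "(UNIV :: 'e set) \<noteq> {0}"
    and cone: "tvs_cone P"
    and e: "e \<in> interior P"
    and cms: "tvs_cone_metric_space P X p"
    and T: "T \<in> X \<rightarrow> X"
    and contr: "\<forall>x\<in>X. \<forall>y\<in>X. cone_le P (p (T x) (T y)) (\<phi> (p x y))"
    and phi_maps: "\<phi> \<in> P \<rightarrow> P"
    and phi_mono: "monotone_on P (cone_le P) (cone_le P) \<phi>"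
    and phi_cont: "continuous_on P \<phi>"
    and phi_0: "\<phi> 0 = 0"
    and phi_less: "\<forall>r>0. cone_ll P (\<phi> (r *\<^sub>R e)) (r *\<^sub>R e)"
  shows "\<exists>\<psi> :: real \<Rightarrow> real.
           \<psi> \<in> {0..} \<rightarrow> {0..} \<and>
           continuous_on {0..} \<psi> \<and>
           mono_on {0..} \<psi> \<and>
           (\<forall>t>0. \<psi> t < t) \<and>
           (\<forall>x\<in>X. \<forall>y\<in>X.
              scalarized_dist P e p (T x) (T y) \<le> \<psi> (scalarized_dist P e p x y))"
proof -
  interpret solid_cone P e
    using cone e nontrivial by unfold_locales
  define \<psi> where "\<psi> t = \<xi> (\<phi> (t *\<^sub>R e))" for t
  have "\<psi> \<in> {0..} \<rightarrow> {0..}"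
    using phi_maps by (auto simp: \<psi>_def intro!: scalarization_nonneg ray_in_cone)
  moreover have "continuous_on {0..} \<psi>"
    unfolding \<psi>_def
    by (intro continuous_on_compose2[OF continuous_on_scalarization]
        continuous_on_compose2[OF phi_cont] continuous_on_scaleR_tvs continuous_intros)
      (auto intro: ray_in_cone)
  moreover have "mono_on {0..} \<psi>"
  proof (rule mono_onI)
    fix s t :: real
    assume st: "s \<in> {0..}" "t \<in> {0..}" "s \<le> t"
    then have "cone_le P (s *\<^sub>R e) (t *\<^sub>R e)"
      using ray_in_cone[of "t - s"] by (simp add: cone_le_def scaleR_left_diff_distrib)
    then have "cone_le P (\<phi> (s *\<^sub>R e)) (\<phi> (t *\<^sub>R e))"
      using st by (intro monotone_onD[OF phi_mono]) (auto intro: ray_in_cone)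
    then show "\<psi> s \<le> \<psi> t"
      unfolding \<psi>_def by (rule scalarization_mono)
  qed
  moreover have "\<forall>t>0. \<psi> t < t"
    using phi_less by (simp add: \<psi>_def scalarization_less_iff cone_ll_def)
  moreover have "scalarized_dist P e p (T x) (T y) \<le> \<psi> (scalarized_dist P e p x y)"
    if "x \<in> X" "y \<in> X" for x y
  proof -
    have p: "p x y \<in> P"
      using cms that by (auto simp: tvs_cone_metric_space_def cone_le_def)
    have "\<xi> (p (T x) (T y)) \<le> \<xi> (\<phi> (p x y))"
      using contr that by (blast intro: scalarization_mono)
    also have "\<dots> \<le> \<xi> (\<phi> (\<xi> (p x y) *\<^sub>R e))"
      using p by (intro scalarization_mono monotone_onD[OF phi_mono] scalarization_bound
          ray_in_cone scalarization_nonneg)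
    finally show ?thesis
      by (simp add: \<psi>_def scalarized_dist_def)
  qed
  ultimately show ?thesis by blast
qed

end
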